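(* Let $m\ge1$, $R=GR(4^m)$ and $\mathcal T=\{0,1,\xi,\dots,\xi^{2^m-2}\}\subseteq R$. Let $\Omega$ be any system of linear equations over $\mathbb Z_4$ in variables $c_x$, $x\in\mathcal T$, which includes the equations $$\sum_{x\in\mathcal T}c_x=0,\qquad \sum_{x\in\mathcal T}c_x x=0,$$ together with (possibly) some equations of the form $2\sum_{x\in\mathcal T}c_x x^{2^j+1}=0$. Then $\Omega$ is invariant under the doubly transitive group $G$ of `affine' permutations of $\mathcal T$ of the form $x\mapsto(ax+b)^{2^m}$ with $a,b\in\mathcal T$, $a\ne0$; i.e. if $(c_x)_{x\in\mathcal T}$ is a solution of $\Omega$ and $g\in G$, then $(c'_y)$ defined by $c'_{g(x)}=c_x$ is also a solution. The order of $G$ is $2^m(2^m-1)$.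
   Context: Let $h_2(X)\in\mathbb Z_2[X]$ be primitive irreducible of degree $m$ and $h(X)\in\mathbb Z_4[X]$ the unique monic degree-$m$ polynomial with $h\equiv h_2\pmod 2$ and $h\mid X^{2^m-1}-1$ in $\mathbb Z_4[X]$. The Galois ring is $R=\mathbb Z_4[X]/(h(X))$ with $\xi$ the class of $X$; equations with coefficients in $R$ are understood as equations in $R$ (equivalently, systems of equations over $\mathbb Z_4$ via the additive representation $c=\sum_{r=0}^{m-1}b_r\xi^r$, $b_r\in\mathbb Z_4$). For $c\in R$, $c^{2^m}\in\mathcal T$. *)

theory Defs
  imports
    "HOL-Computational_Algebra.Polynomial"
    "HOL-Library.Z2"
    "HOL-Library.Numeral_Type"
    "HOL-Algebra.QuotRing"
    "HOL-Algebra.Bij"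
begin

text \<open>
  The field with two elements is the type \<^typ>\<open>bit\<close>; the ring of integers modulo 4 is the
  numeral type \<^typ>\<open>4\<close>.  The type class ring \<open>'a poly\<close> is turned into a record so that its
  quotients are available as rings.
\<close>

definition poly_ring :: "'a::comm_ring_1 poly ring" where
  "poly_ring = \<lparr>carrier = UNIV, mult = (*), one = 1, zero = 0, add = (+)\<rparr>"

definition poly_quot :: "'a::comm_ring_1 poly \<Rightarrow> 'a poly set ring" where
  "poly_quot p = poly_ring Quot (PIdl\<^bsub>poly_ring\<^esub> p)"

definition residue_class :: "'a::comm_ring_1 poly \<Rightarrow> 'a poly \<Rightarrow> 'a poly set" where
  "residue_class p f = PIdl\<^bsub>poly_ring\<^esub> p +>\<^bsub>poly_ring\<^esub> f"

definition root_class :: "'a::comm_ring_1 poly \<Rightarrow> 'a poly set" where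
  "root_class p = residue_class p [:0, 1:]"

text \<open>Primitive: the root \<open>X mod p\<close> generates the multiplicative group of the field
  \<open>\<int>\<^sub>2[X]/(p)\<close>.\<close>

definition primitive_irreducible :: "bit poly \<Rightarrow> bool" where
  "primitive_irreducible p \<longleftrightarrow> irreducible p \<and>
     carrier (poly_quot p) - {\<zero>\<^bsub>poly_quot p\<^esub>} = {root_class p [^]\<^bsub>poly_quot p\<^esub> k | k::nat. True}"

text \<open>\<^const>\<open>Rep_bit0\<close> returns the representative in \<open>{0..<4}\<close>.\<close>

definition reduce_mod2 :: "4 \<Rightarrow> bit" where
  "reduce_mod2 a = of_int (Rep_bit0 a)"

text \<open>
  The polynomial \<open>h\<close> such that \<open>\<int>\<^sub>4[X]/(h)\<close> is the Galois ring \<open>GR(4^m)\<close>.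
\<close>

definition basic_primitive_lift :: "nat \<Rightarrow> bit poly \<Rightarrow> 4 poly \<Rightarrow> bool" where
  "basic_primitive_lift m h2 h \<longleftrightarrow>
     primitive_irreducible h2 \<and> degree h2 = m \<and>
     lead_coeff h = 1 \<and> degree h = m \<and>
     map_poly reduce_mod2 h = h2 \<and> h dvd monom 1 (2 ^ m - 1) - 1"

definition teich :: "nat \<Rightarrow> 4 poly \<Rightarrow> 4 poly set set" where
  "teich m h = {\<zero>\<^bsub>poly_quot h\<^esub>} \<union> {root_class h [^]\<^bsub>poly_quot h\<^esub> i | i::nat. i < 2 ^ m - 1}"

text \<open>The sum \<open>\<Sum>\<^sub>x c\<^sub>x x\<^sup>e\<close> over the Teichmueller set, as an element of \<open>\<int>\<^sub>4[X]/(h)\<close>;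
  the scalar \<open>c\<^sub>x\<close> acts through the constant polynomials.\<close>

definition power_moment :: "nat \<Rightarrow> 4 poly \<Rightarrow> (4 poly set \<Rightarrow> 4) \<Rightarrow> nat \<Rightarrow> 4 poly set" where
  "power_moment m h c e =
     (\<Oplus>\<^bsub>poly_quot h\<^esub>x\<in>teich m h. residue_class h [:c x:] \<otimes>\<^bsub>poly_quot h\<^esub> (x [^]\<^bsub>poly_quot h\<^esub> e))"

text \<open>Solutions of the system consisting of the two compulsory equations and the optional
  ones with index \<open>j \<in> J\<close>.  Only the values of \<open>c\<close> on \<^term>\<open>teich m h\<close> matter.\<close>

definition solves :: "nat \<Rightarrow> 4 poly \<Rightarrow> nat set \<Rightarrow> (4 poly set \<Rightarrow> 4) \<Rightarrow> bool" where
  "solves m h J c \<longleftrightarrow>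
     (\<Sum>x\<in>teich m h. c x) = 0 \<and>
     power_moment m h c 1 = \<zero>\<^bsub>poly_quot h\<^esub> \<and>
     (\<forall>j\<in>J. [(2::nat)] \<cdot>\<^bsub>poly_quot h\<^esub> power_moment m h c (2 ^ j + 1) = \<zero>\<^bsub>poly_quot h\<^esub>)"

definition affine_map :: "nat \<Rightarrow> 4 poly \<Rightarrow> 4 poly set \<Rightarrow> 4 poly set \<Rightarrow> 4 poly set \<Rightarrow> 4 poly set" where
  "affine_map m h a b = (\<lambda>x\<in>teich m h.
     (a \<otimes>\<^bsub>poly_quot h\<^esub> x \<oplus>\<^bsub>poly_quot h\<^esub> b) [^]\<^bsub>poly_quot h\<^esub> ((2::nat) ^ m))"

definition affine_perms :: "nat \<Rightarrow> 4 poly \<Rightarrow> (4 poly set \<Rightarrow> 4 poly set) set" where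
  "affine_perms m h = {affine_map m h a b | a b.
     a \<in> teich m h \<and> b \<in> teich m h \<and> a \<noteq> \<zero>\<^bsub>poly_quot h\<^esub>}"

definition doubly_transitive_on :: "('a \<Rightarrow> 'a) set \<Rightarrow> 'a set \<Rightarrow> bool" where
  "doubly_transitive_on G S \<longleftrightarrow>
     (\<forall>x\<in>S. \<forall>y\<in>S. \<forall>u\<in>S. \<forall>v\<in>S. x \<noteq> y \<longrightarrow> u \<noteq> v \<longrightarrow> (\<exists>g\<in>G. g x = u \<and> g y = v))"

end

theory Submission
  imports Defs
begin

text \<open>
  Reduction modulo 2 identifies the Teichmueller set with the residue field
  \<open>\<int>\<^sub>2[X]/(h\<^sub>2)\<close>: the map \<open>u \<mapsto> u^(2^m)\<close> sends an element of \<open>R\<close> to the unique Teichmueller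
  element congruent to it modulo 2.  Under this identification the maps
  \<open>x \<mapsto> (ax + b)^(2^m)\<close> are the affine maps of the field, which gives the group, its order and
  double transitivity.  For the invariance, characteristic 4 gives
  \<open>(ax + b)^(2^m) = ax + b + 2 (abx)^(2^(m-1))\<close> for Teichmueller \<open>a, b, x\<close>, and
  \<open>2 \<Sum>\<^sub>x c\<^sub>x x^(2^i) = 2 (\<Sum>\<^sub>x c\<^sub>x x)^(2^i)\<close> because \<open>c\<^sub>x\<^sup>2 \<equiv> c\<^sub>x\<close> modulo 2; so every new
  moment is a combination of the old moments, which vanish.
\<close>

subsection \<open>Quotients of polynomial rings\<close>

lemma poly_ring_sel [simp]:
  "carrier poly_ring = UNIV" "mult poly_ring = (*)" "one poly_ring = 1"
  "zero poly_ring = 0" "add poly_ring = (+)"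
  by (simp_all add: poly_ring_def)

lemma cring_poly_ring: "cring (poly_ring :: 'a::comm_ring_1 poly ring)"
proof (rule cringI)
  show "abelian_group (poly_ring :: 'a poly ring)"
  proof (rule abelian_groupI)
    show "\<exists>y\<in>carrier poly_ring. y \<oplus>\<^bsub>poly_ring\<^esub> x = \<zero>\<^bsub>poly_ring\<^esub>" for x :: "'a poly"
      by (rule bexI [of _ "- x"]) simp_all
  qed (simp_all add: algebra_simps)
  show "comm_monoid (poly_ring :: 'a poly ring)"
    by (rule comm_monoidI) (simp_all add: algebra_simps)
qed (simp add: algebra_simps)

lemma ideal_PIdl_poly_ring: "ideal (PIdl\<^bsub>poly_ring\<^esub> p) poly_ring"
  by (rule cring.cgenideal_ideal [OF cring_poly_ring]) simp

lemma cring_poly_quot: "cring (poly_quot p)"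
  unfolding poly_quot_def
  by (rule ideal.quotient_is_cring [OF ideal_PIdl_poly_ring cring_poly_ring])

lemma residue_class_hom: "residue_class p \<in> ring_hom poly_ring (poly_quot p)"
  unfolding poly_quot_def residue_class_def
  by (rule ideal.rcos_ring_hom [OF ideal_PIdl_poly_ring])

lemma residue_class_add:
    "residue_class p (f + g) = residue_class p f \<oplus>\<^bsub>poly_quot p\<^esub> residue_class p g"
  and residue_class_mult:
    "residue_class p (f * g) = residue_class p f \<otimes>\<^bsub>poly_quot p\<^esub> residue_class p g"
  and residue_class_1: "residue_class p 1 = \<one>\<^bsub>poly_quot p\<^esub>"
  and residue_class_closed: "residue_class p f \<in> carrier (poly_quot p)"
  using ring_hom_add [OF residue_class_hom, of f g p] ring_hom_mult [OF residue_class_hom, of f g p]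
    ring_hom_one [OF residue_class_hom, of p] ring_hom_closed [OF residue_class_hom, of f p]
  by simp_all

lemma residue_class_0: "residue_class p 0 = \<zero>\<^bsub>poly_quot p\<^esub>"
proof -
  interpret cring "poly_quot p" by (rule cring_poly_quot)
  have "residue_class p 0 \<oplus>\<^bsub>poly_quot p\<^esub> residue_class p 0 = residue_class p 0"
    by (simp flip: residue_class_add)
  then show ?thesis
    using add.l_cancel_one residue_class_closed by blast
qed

lemma residue_class_power: "residue_class p (f ^ n) = residue_class p f [^]\<^bsub>poly_quot p\<^esub> n"
proof -
  interpret cring "poly_quot p" by (rule cring_poly_quot)
  show ?thesis
    by (induction n) (simp_all add: residue_class_1 residue_class_mult power_Suc2 del: power_Suc)
qed

lemma residue_class_sum:
  "finite A \<Longrightarrow> residue_class p (\<Sum>i\<in>A. f i) = (\<Oplus>\<^bsub>poly_quot p\<^esub>i\<in>A. residue_class p (f i))"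
proof (induction A rule: finite_induct)
  interpret cring "poly_quot p" by (rule cring_poly_quot)
  case empty
  then show ?case by (simp add: residue_class_0)
next
  interpret cring "poly_quot p" by (rule cring_poly_quot)
  case (insert i A)
  then show ?case by (simp add: residue_class_add residue_class_closed Pi_def)
qed

lemma residue_class_double:
  "residue_class p (2 * f) = [(2::nat)] \<cdot>\<^bsub>poly_quot p\<^esub> residue_class p f"
proof -
  interpret cring "poly_quot p" by (rule cring_poly_quot)
  have "[(2::nat)] \<cdot>\<^bsub>poly_quot p\<^esub> residue_class p f =
      residue_class p f \<oplus>\<^bsub>poly_quot p\<^esub> residue_class p f"
    using residue_class_closed [of p f] by (simp add: numeral_2_eq_2)
  then show ?thesis
    by (simp only: mult_2 residue_class_add)
qed

text \<open>Turns equations in the quotient into divisibility of polynomials, so that later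
  computations can run on representatives in a type-class ring instead of inside the quotient
  record.\<close>

lemma residue_class_eq_iff: "residue_class p f = residue_class p g \<longleftrightarrow> p dvd f - g"
proof -
  have cl: "residue_class p f = {q. p dvd q - f}" for f
  proof -
    have "residue_class p f = {x * p + f | x. True}"
      by (auto simp: residue_class_def cgenideal_def a_r_coset_def' image_def)
    also have "\<dots> = {q. p dvd q - f}"
      by (auto simp: dvd_def algebra_simps)
    finally show ?thesis .
  qed
  show ?thesis
  proof
    assume "residue_class p f = residue_class p g"
    moreover have "f \<in> residue_class p f" by (simp add: cl)
    ultimately have "f \<in> residue_class p g" by simp
    then show "p dvd f - g" by (simp add: cl)
  next
    assume a: "p dvd f - g"
    have "p dvd q - f \<longleftrightarrow> p dvd q - g" for q
      using dvd_add_left_iff [OF a, of "q - f"] by simp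
    then show "residue_class p f = residue_class p g" by (simp add: cl)
  qed
qed

lemma residue_class_add_cong:
  "residue_class p f = residue_class p f' \<Longrightarrow> residue_class p g = residue_class p g' \<Longrightarrow>
    residue_class p (f + g) = residue_class p (f' + g')"
  by (simp add: residue_class_add)

lemma residue_class_mult_cong:
  "residue_class p f = residue_class p f' \<Longrightarrow> residue_class p g = residue_class p g' \<Longrightarrow>
    residue_class p (f * g) = residue_class p (f' * g')"
  by (simp add: residue_class_mult)

lemma residue_class_power_cong:
  "residue_class p f = residue_class p f' \<Longrightarrow> residue_class p (f ^ n) = residue_class p (f' ^ n)"
  by (simp add: residue_class_power)

lemma residue_class_sum_cong:
  "finite A \<Longrightarrow> (\<And>i. i \<in> A \<Longrightarrow> residue_class p (f i) = residue_class p (g i)) \<Longrightarrow>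
    residue_class p (\<Sum>i\<in>A. f i) = residue_class p (\<Sum>i\<in>A. g i)"
  by (induction A rule: finite_induct) (simp_all add: residue_class_add)

subsection \<open>Reduction modulo 2 and arithmetic in characteristic 4\<close>

lemma type_4_cases: "(x::4) = 0 \<or> x = 1 \<or> x = 2 \<or> x = 3"
proof (cases x rule: bit0_cases)
  case (of_int z)
  then have "z \<in> {0,1,2,3}" by auto
  then show ?thesis using of_int by auto
qed

lemma reduce_mod2_simps [simp]:
  "reduce_mod2 0 = 0" "reduce_mod2 1 = 1" "reduce_mod2 (numeral w) = of_int (numeral w mod 4)"
  by (simp_all add: reduce_mod2_def bit0.Rep_0 bit0.Rep_1 bit0.Rep_numeral)

lemma reduce_mod2_add: "reduce_mod2 (a + b) = reduce_mod2 a + reduce_mod2 b"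
  using type_4_cases [of a] type_4_cases [of b] by auto

lemma reduce_mod2_mult: "reduce_mod2 (a * b) = reduce_mod2 a * reduce_mod2 b"
  using type_4_cases [of a] type_4_cases [of b] by auto

lemma reduce_mod2_eq_0: "reduce_mod2 a = 0 \<Longrightarrow> \<exists>b. a = 2 * b"
  using type_4_cases [of a] by (auto intro: exI[of _ 0] exI[of _ 1])

text \<open>\<open>c * c - c\<close> is even, and doubling an even element gives 0 modulo 4. This
  lets scalars pass through powers with exponent \<open>2 ^ k\<close> below.\<close>

lemma double_mult_self: "2 * (c * c) = 2 * (c :: 4)"
  using type_4_cases [of c] by auto

section \<open>Powers with exponent \<open>2 ^ k\<close> in characteristic 4\<close>

lemma power2_add_double:
  fixes x z :: "'a::comm_ring_1"
  assumes "(4::'a) = 0"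
  shows "(x + 2 * z)\<^sup>2 = x\<^sup>2"
proof -
  have "(x + 2 * z)\<^sup>2 = x\<^sup>2 + 4 * (x * z + z\<^sup>2)"
    by (simp add: power2_eq_square algebra_simps)
  then show ?thesis by (simp add: assms)
qed

lemma power_2power_add_double:
  fixes x z :: "'a::comm_ring_1"
  assumes "(4::'a) = 0" "k > 0"
  shows "(x + 2 * z) ^ (2 ^ k) = x ^ (2 ^ k)"
proof -
  obtain l where "k = Suc l" using assms(2) gr0_implies_Suc by blast
  then show ?thesis
    by (simp add: power_mult power2_add_double [OF assms(1)])
qed

text \<open>Each further squaring kills the even correction left by the previous one, by
  \<open>power2_add_double\<close>, and creates a new one as the cross term of the two remaining
  powers. Hence exactly one correction survives, whatever \<open>k\<close> is.\<close>

lemma power_2power_Suc_add: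
  fixes x y :: "'a::comm_ring_1"
  assumes "(4::'a) = 0"
  shows "(x + y) ^ (2 ^ Suc k) = x ^ (2 ^ Suc k) + y ^ (2 ^ Suc k) + 2 * (x * y) ^ (2 ^ k)"
proof (induction k)
  case 0
  show ?case by (simp add: power2_eq_square algebra_simps)
next
  case (Suc k)
  have sq: "a ^ (2 ^ Suc l) = (a ^ (2 ^ l))\<^sup>2" for a :: 'a and l
    by (simp add: mult.commute flip: power_mult)
  have "(x + y) ^ (2 ^ Suc (Suc k)) =
      (x ^ (2 ^ Suc k) + y ^ (2 ^ Suc k) + 2 * (x * y) ^ (2 ^ k))\<^sup>2"
    by (simp only: sq [of _ "Suc k"] Suc.IH)
  also have "\<dots> = (x ^ (2 ^ Suc k) + y ^ (2 ^ Suc k))\<^sup>2"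
    by (rule power2_add_double [OF assms])
  also have "\<dots> = x ^ (2 ^ Suc (Suc k)) + y ^ (2 ^ Suc (Suc k)) + 2 * (x * y) ^ (2 ^ Suc k)"
    by (simp only: sq [of _ "Suc k"] power2_sum power_mult_distrib mult.assoc)
  finally show ?case .
qed

text \<open>The correction term in \<open>power_2power_Suc_add\<close> already carries a factor 2,
  so doubling removes it. Frobenius powers are thus additive under the factor 2, including the
  trivial case \<open>k = 0\<close>.\<close>

lemma double_power_2power_add:
  fixes x y :: "'a::comm_ring_1"
  assumes "(4::'a) = 0"
  shows "2 * (x + y) ^ (2 ^ k) = 2 * (x ^ (2 ^ k) + y ^ (2 ^ k))"
proof (cases k)
  case (Suc l)
  have "2 * (2 * (x * y) ^ (2 ^ l)) = 4 * (x * y) ^ (2 ^ l)" by simp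
  then show ?thesis
    unfolding Suc power_2power_Suc_add [OF assms] by (simp only: assms distrib_left) simp
qed simp

text \<open>Under a factor 2 only residues modulo 2 matter, so here the exponent is arbitrary and
  need not be a power of 2.\<close>

lemma double_power_add_double:
  fixes x z :: "'a::comm_ring_1"
  assumes "(4::'a) = 0"
  shows "2 * (x + 2 * z) ^ n = 2 * x ^ n"
proof (induction n)
  case (Suc n)
  have "2 * (x + 2 * z) ^ Suc n = (x + 2 * z) * (2 * (x + 2 * z) ^ n)"
    by (simp add: mult_ac)
  also have "\<dots> = 2 * x ^ Suc n + 4 * (z * x ^ n)"
    unfolding Suc.IH by (simp add: algebra_simps)
  finally show ?case by (simp add: assms)
qed simp

lemma four_poly_4 [simp]: "(4 :: 4 poly) = 0"
  by (simp add: numeral_poly)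

lemma double_const_power: "2 * [:c:] ^ (2 ^ k) = 2 * [:c :: 4:]"
proof (induction k)
  case (Suc k)
  have "2 * [:c:] ^ (2 ^ Suc k) = [:c:] ^ (2 ^ k) * (2 * [:c:] ^ (2 ^ k))"
    by (simp only: power_Suc mult_2 [of "2 ^ k :: nat"] power_add mult_ac)
  also have "\<dots> = [:c:] * (2 * [:c:] ^ (2 ^ k))"
    by (simp add: Suc.IH mult_ac)
  also have "\<dots> = 2 * [:c:]"
    unfolding Suc.IH using double_mult_self [of c] by (simp add: numeral_poly mult_ac)
  finally show ?case .
qed simp

text \<open>Modulo 2 the Frobenius power is additive and fixes the scalars. For the linear system
  this means that the first moment controls every doubled moment with exponent
  \<open>2 ^ k\<close>.\<close>

lemma double_sum_power_2power:
  fixes f :: "'a \<Rightarrow> 4 poly"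
  assumes "finite A"
  shows "2 * (\<Sum>x\<in>A. [:c x:] * f x) ^ (2 ^ k) = 2 * (\<Sum>x\<in>A. [:c x:] * f x ^ (2 ^ k))"
  using assms
proof (induction A rule: finite_induct)
  case empty
  then show ?case by (simp add: power_0_left)
next
  case (insert a A)
  have "2 * (\<Sum>x\<in>insert a A. [:c x:] * f x) ^ (2 ^ k) =
      2 * ([:c a:] * f a) ^ (2 ^ k) + 2 * (\<Sum>x\<in>A. [:c x:] * f x) ^ (2 ^ k)"
    by (simp only: sum.insert [OF insert.hyps] double_power_2power_add [OF four_poly_4] distrib_left)
  also have "2 * ([:c a:] * f a) ^ (2 ^ k) = (2 * [:c a:] ^ (2 ^ k)) * f a ^ (2 ^ k)"
    by (simp only: power_mult_distrib mult.assoc)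
  finally show ?case
    unfolding double_const_power insert.IH
    by (simp only: sum.insert [OF insert.hyps] distrib_left mult.assoc)
qed

section \<open>Coefficientwise reduction of polynomials modulo 2\<close>

abbreviation reduce_poly :: "4 poly \<Rightarrow> bit poly" where
  "reduce_poly \<equiv> map_poly reduce_mod2"

lemma reduce_poly_add: "reduce_poly (f + g) = reduce_poly f + reduce_poly g"
  by (rule poly_eqI) (simp add: coeff_map_poly reduce_mod2_add)

lemma reduce_poly_diff: "reduce_poly (f - g) = reduce_poly f - reduce_poly g"
  using reduce_poly_add [of "f - g" g] by (simp add: algebra_simps)

lemma reduce_poly_mult: "reduce_poly (f * g) = reduce_poly f * reduce_poly g"
proof (rule poly_eqI)
  have "reduce_mod2 (\<Sum>i\<in>A. s i) = (\<Sum>i\<in>A. reduce_mod2 (s i))" if "finite A"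
    for s and A :: "nat set"
    using that by (induction A rule: finite_induct) (simp_all add: reduce_mod2_add)
  then show "coeff (reduce_poly (f * g)) n = coeff (reduce_poly f * reduce_poly g) n" for n
    by (simp add: coeff_map_poly coeff_mult reduce_mod2_mult)
qed

lemma reduce_poly_power: "reduce_poly (f ^ n) = reduce_poly f ^ n"
  by (induction n) (simp_all add: reduce_poly_mult)

lemma reduce_poly_X [simp]: "reduce_poly [:0, 1:] = [:0, 1:]"
  by (simp add: map_poly_pCons)

lemma reduce_poly_eq_0:
  assumes "reduce_poly f = 0"
  obtains g where "f = 2 * g"
proof -
  \<comment> \<open>Halves are not unique, as \<open>2 * 2 = 0\<close> modulo 4. Insisting on half 0
    for a zero coefficient makes the chosen sequence vanish almost everywhere, as
    \<open>Abs_poly\<close> requires.\<close>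
  have "\<exists>b. coeff f i = 2 * b \<and> (coeff f i = 0 \<longrightarrow> b = 0)" for i
    using reduce_mod2_eq_0 [of "coeff f i"] assms
    by (metis coeff_0 coeff_map_poly mult_zero_right reduce_mod2_simps(1))
  then obtain b where b: "\<And>i. coeff f i = 2 * b i" "\<And>i. coeff f i = 0 \<Longrightarrow> b i = 0"
    by metis
  have "coeff (Abs_poly b) = b"
    using b(2) MOST_coeff_eq_0 [of f] by (intro Abs_poly_inverse) (auto elim: MOST_mono)
  then have "f = 2 * Abs_poly b"
    by (intro poly_eqI) (simp add: b(1) numeral_poly)
  then show thesis by (rule that)
qed

lemma reduce_poly_surj: obtains f where "reduce_poly f = g"
proof -
  have "reduce_poly (map_poly (\<lambda>b. if b = 0 then 0 else 1) g) = g"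
    by (rule poly_eqI) (auto simp: coeff_map_poly)
  then show thesis by (rule that)
qed

text \<open>The root has order dividing \<open>n\<close>. The modulus and its coefficient ring are
  kept general because this serves both \<open>h\<close> modulo 4 and \<open>h2\<close> modulo
  2.\<close>

lemma residue_class_X_power:
  assumes "p dvd monom 1 n - 1"
  shows "residue_class p ([:0, 1:] ^ (j + n * i)) = residue_class p ([:0, 1:] ^ j)"
proof -
  have "residue_class p ([:0, 1:] ^ n) = residue_class p 1"
    using assms by (simp add: residue_class_eq_iff monom_altdef)
  then have "residue_class p ([:0, 1:] ^ j * ([:0, 1:] ^ n) ^ i) = residue_class p ([:0, 1:] ^ j * 1 ^ i)"
    by (intro residue_class_mult_cong residue_class_power_cong refl)
  then show ?thesis by (simp add: power_add power_mult)
qed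

subsection \<open>The Teichmueller set and the residue field\<close>

locale primitive_lift =
  fixes m :: nat and h2 :: "bit poly" and h :: "4 poly"
  assumes m_pos: "m \<ge> 1" and lift: "basic_primitive_lift m h2 h"
begin

text \<open>The Teichmueller lift, indexed by polynomials modulo 4, so that one representative
  \<open>u\<close> stands both for a residue modulo 2 and for the Teichmueller element above
  it.\<close>

definition \<tau> :: "4 poly \<Rightarrow> 4 poly set" where
  "\<tau> u = residue_class h (u ^ (2 ^ m))"

lemma degree_h2: "degree h2 = m"
  and reduce_h: "reduce_poly h = h2"
  and h_dvd: "h dvd monom 1 (2 ^ m - 1) - 1"
  and primitive_h2: "primitive_irreducible h2"
  using lift by (auto simp: basic_primitive_lift_def)

lemma h2_dvd_reduce: "h dvd f \<Longrightarrow> h2 dvd reduce_poly f"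
  by (auto simp: dvd_def reduce_poly_mult reduce_h)

lemma h2_dvd: "h2 dvd monom 1 (2 ^ m - 1) - 1"
  using h2_dvd_reduce [OF h_dvd] by (simp add: reduce_poly_diff map_poly_monom)

text \<open>Primitivity enters here: a nonzero class modulo \<open>h2\<close> is a power of the
  root.\<close>

lemma reduce_cases:
  obtains "h2 dvd reduce_poly u"
  | k where "residue_class h2 (reduce_poly u) = residue_class h2 ([:0, 1:] ^ k)"
proof (cases "residue_class h2 (reduce_poly u) = \<zero>\<^bsub>poly_quot h2\<^esub>")
  case True
  then show thesis
    using that(1) residue_class_eq_iff [of h2 "reduce_poly u" 0] by (simp add: residue_class_0)
next
  case False
  then have "residue_class h2 (reduce_poly u) \<in> carrier (poly_quot h2) - {\<zero>\<^bsub>poly_quot h2\<^esub>}"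
    by (simp add: residue_class_closed)
  then show thesis
    using that(2) primitive_h2
    by (auto simp: primitive_irreducible_def root_class_def residue_class_power)
qed

lemma X_power_order:
  assumes "p dvd monom 1 (2 ^ m - 1) - 1"
  shows "residue_class p (([:0, 1:] ^ i) ^ (2 ^ m)) = residue_class p ([:0, 1:] ^ i)"
proof -
  have "i * 2 ^ m = i + (2 ^ m - 1) * i"
    by (simp add: algebra_simps)
  then show ?thesis
    using residue_class_X_power [OF assms, of i i] by (simp only: flip: power_mult)
qed

text \<open>Fermat's theorem for the residue field, obtained from the order of the root rather than
  by counting units.\<close>

lemma frobenius_h2:
  "residue_class h2 (reduce_poly u ^ (2 ^ m)) = residue_class h2 (reduce_poly u)"
proof (cases rule: reduce_cases [of u])
  case 1
  then have "residue_class h2 (reduce_poly u) = residue_class h2 0"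
    by (simp add: residue_class_eq_iff)
  from residue_class_power_cong [OF this, of "2 ^ m"] this show ?thesis
    by (simp add: power_0_left)
next
  case (2 k)
  from residue_class_power_cong [OF this, of "2 ^ m"] this X_power_order [OF h2_dvd, of k]
  show ?thesis by simp
qed

text \<open>Reducing modulo 2 recovers the residue of \<open>u\<close> from its lift, since the
  Frobenius power is the identity there. Conversely, representatives that agree modulo 2 and
  \<open>h2\<close> differ modulo \<open>h\<close> by some \<open>2 * p\<close>, which the power
  removes.\<close>

lemma tau_eq_iff:
  "\<tau> u = \<tau> v \<longleftrightarrow> residue_class h2 (reduce_poly u) = residue_class h2 (reduce_poly v)"
proof
  assume "\<tau> u = \<tau> v"
  then have "h2 dvd reduce_poly (u ^ (2 ^ m)) - reduce_poly (v ^ (2 ^ m))"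
    by (simp add: \<tau>_def residue_class_eq_iff h2_dvd_reduce flip: reduce_poly_diff)
  then show "residue_class h2 (reduce_poly u) = residue_class h2 (reduce_poly v)"
    by (simp add: reduce_poly_power frobenius_h2 flip: residue_class_eq_iff)
next
  assume "residue_class h2 (reduce_poly u) = residue_class h2 (reduce_poly v)"
  then obtain w where w: "reduce_poly (u - v) = h2 * w"
    by (auto simp: residue_class_eq_iff reduce_poly_diff dvd_def)
  obtain q where q: "reduce_poly q = w" by (rule reduce_poly_surj)
  have "reduce_poly (u - v - h * q) = 0"
    by (simp only: reduce_poly_diff [of "u - v"] reduce_poly_mult w q reduce_h) simp
  then obtain p where "u - v - h * q = 2 * p" by (rule reduce_poly_eq_0)
  then have "u - (v + 2 * p) = h * q" by (simp add: algebra_simps)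
  then have "residue_class h u = residue_class h (v + 2 * p)"
    by (simp add: residue_class_eq_iff)
  then have "\<tau> u = residue_class h ((v + 2 * p) ^ (2 ^ m))"
    unfolding \<tau>_def by (rule residue_class_power_cong)
  \<comment> \<open>As \<open>m \<ge> 1\<close>, the exponent contains at least one squaring, which
    is what kills \<open>2 * p\<close>.\<close>
  then show "\<tau> u = \<tau> v"
    using m_pos by (simp only: power_2power_add_double [OF four_poly_4] \<tau>_def)
qed

lemma tau_cong: "residue_class h u = residue_class h v \<Longrightarrow> \<tau> u = \<tau> v"
  unfolding \<tau>_def by (rule residue_class_power_cong)

text \<open>With the next two lemmas this allows calculating with \<tau>-values as in the residue
  field, without defining an addition on the Teichmueller set, which is not closed under that of the
  ring.\<close>

lemma tau_add_cong: "\<tau> u = \<tau> u' \<Longrightarrow> \<tau> v = \<tau> v' \<Longrightarrow> \<tau> (u + v) = \<tau> (u' + v')"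
  unfolding tau_eq_iff reduce_poly_add by (rule residue_class_add_cong)

lemma tau_mult_cong: "\<tau> u = \<tau> u' \<Longrightarrow> \<tau> v = \<tau> v' \<Longrightarrow> \<tau> (u * v) = \<tau> (u' * v')"
  unfolding tau_eq_iff reduce_poly_mult by (rule residue_class_mult_cong)

lemma tau_power: "\<tau> (u ^ (2 ^ m)) = \<tau> u"
  unfolding tau_eq_iff reduce_poly_power by (rule frobenius_h2)

lemma tau_0: "\<tau> 0 = \<zero>\<^bsub>poly_quot h\<^esub>"
  by (simp add: \<tau>_def power_0_left residue_class_0)

lemma tau_eq_0_iff: "\<tau> u = \<zero>\<^bsub>poly_quot h\<^esub> \<longleftrightarrow> h2 dvd reduce_poly u"
  using tau_eq_iff [of u 0] by (simp add: tau_0 residue_class_eq_iff)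

lemma tau_X_power: "\<tau> ([:0, 1:] ^ i) = residue_class h ([:0, 1:] ^ i)"
  unfolding \<tau>_def by (rule X_power_order [OF h_dvd])

section \<open>Enumeration and size of the Teichmueller set\<close>

lemma tau_cases:
  obtains "\<tau> u = \<zero>\<^bsub>poly_quot h\<^esub>" | i where "i < 2 ^ m - 1" "\<tau> u = \<tau> ([:0, 1:] ^ i)"
proof (cases rule: reduce_cases [of u])
  case 1
  then show thesis using that(1) by (simp add: tau_eq_0_iff)
next
  case (2 k)
  let ?n = "2 ^ m - 1 :: nat"
  \<comment> \<open>Guarantees \<open>2 ^ m - 1 > 0\<close>, so that the remainder of
    \<open>k\<close> is an admissible exponent, also for \<open>m = 1\<close>.\<close>
  have "2 ^ 1 \<le> (2 :: nat) ^ m" using m_pos by (intro power_increasing) auto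
  then have "k mod ?n < ?n" by (intro mod_less_divisor) simp
  moreover have "\<tau> u = \<tau> ([:0, 1:] ^ k)"
    using 2 by (simp add: tau_eq_iff reduce_poly_power)
  moreover have "\<tau> ([:0, 1:] ^ k) = \<tau> ([:0, 1:] ^ (k mod ?n))"
    using residue_class_X_power [OF h_dvd, of "k mod ?n" "k div ?n"]
    by (intro tau_cong) (simp only: mod_mult_div_eq)
  ultimately show thesis using that(2) by metis
qed

lemma teich_eq: "teich m h = range \<tau>"
proof
  show "teich m h \<subseteq> range \<tau>"
    by (auto simp: teich_def root_class_def tau_X_power simp flip: residue_class_power tau_0)
      (metis tau_X_power rangeI)
  show "range \<tau> \<subseteq> teich m h"
  proof clarify
    fix u
    show "\<tau> u \<in> teich m h"
      by (cases rule: tau_cases [of u])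
        (auto simp: teich_def root_class_def tau_X_power simp flip: residue_class_power)
  qed
qed

lemma finite_teich: "finite (teich m h)"
  by (simp add: teich_def)

text \<open>Any \<open>v\<close> with lift \<open>x\<close> can be replaced by
  \<open>v ^ (2 ^ m)\<close>, which in addition represents \<open>x\<close> in the ring itself;
  \<open>v\<close> alone would do so only modulo 2.\<close>

lemma teich_rep:
  assumes "x \<in> teich m h"
  obtains u where "residue_class h u = x" "\<tau> u = x"
proof -
  obtain v where v: "x = \<tau> v" using assms by (auto simp: teich_eq)
  show thesis
    by (rule that [of "v ^ (2 ^ m)"]) (simp_all only: v tau_power \<tau>_def [symmetric])
qed

text \<open>The upper bound counts the listed powers and zero. For the lower bound, the
  \<open>2 ^ m\<close> polynomials of degree below \<open>m\<close> over the two-element field are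
  pairwise incongruent modulo \<open>h2\<close>.\<close>

lemma card_teich: "card (teich m h) = 2 ^ m"
proof (rule antisym)
  let ?P = "\<lambda>i::nat. root_class h [^]\<^bsub>poly_quot h\<^esub> i"
  have "teich m h = insert \<zero>\<^bsub>poly_quot h\<^esub> (?P ` {..<2 ^ m - 1})"
    by (auto simp: teich_def)
  then have "card (teich m h) \<le> Suc (card (?P ` {..<2 ^ m - 1}))"
    by (simp add: card_insert_if)
  also have "\<dots> \<le> Suc (card {..<2 ^ m - 1 :: nat})"
    by (simp only: Suc_le_mono card_image_le finite_lessThan)
  finally show "card (teich m h) \<le> 2 ^ m" by simp
next
  \<comment> \<open>A subset of \<open>{..<m}\<close> encodes the polynomial whose nonzero
    coefficients sit at its elements.\<close>
  define p where "p S = (\<Sum>i\<in>S. monom (1::bit) i)" for S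
  have coeff_p: "coeff (p S) i = (if i \<in> S then 1 else 0)" if "S \<subseteq> {..<m}" for S i
    using finite_subset [OF that] by (simp add: p_def coeff_sum)
  define l where "l S = (SOME u. reduce_poly u = p S)" for S
  have l: "reduce_poly (l S) = p S" for S
    unfolding l_def by (rule someI_ex) (meson reduce_poly_surj)
  have "inj_on (\<lambda>S. \<tau> (l S)) (Pow {..<m})"
  proof (rule inj_onI)
    fix S S' assume S: "S \<in> Pow {..<m}" "S' \<in> Pow {..<m}" and "\<tau> (l S) = \<tau> (l S')"
    then have "h2 dvd p S - p S'" by (simp add: tau_eq_iff l residue_class_eq_iff)
    moreover have "degree (p S - p S') < degree h2"
      unfolding degree_h2 using m_pos S
      by (intro degree_lessI) (auto simp: coeff_p)
    ultimately have "p S - p S' = 0"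
      using dvd_imp_degree_le leD by blast
    then have "coeff (p S) i = coeff (p S') i" for i by simp
    then show "S = S'" using S
      by (auto simp: coeff_p split: if_splits) (metis zero_neq_one)+
  qed
  then have "card (Pow {..<m}) \<le> card (teich m h)"
    by (rule card_inj_on_le) (auto simp: teich_eq finite_teich [unfolded teich_eq])
  then show "2 ^ m \<le> card (teich m h)" by (simp add: card_Pow)
qed

section \<open>Division in the residue field, expressed through \<tau>\<close>

lemma tau_inverse:
  assumes "\<tau> a \<noteq> \<zero>\<^bsub>poly_quot h\<^esub>"
  obtains a' where "\<tau> (a * a') = \<tau> 1" "\<tau> a' \<noteq> \<zero>\<^bsub>poly_quot h\<^esub>"
proof (cases rule: tau_cases [of a])
  case (2 i)
  \<comment> \<open>The exponents of this power and of \<open>[:0, 1:] ^ i\<close> add up to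
    \<open>2 ^ m - 1\<close>, where the root returns to 1.\<close>
  let ?a' = "[:0, 1:] ^ (2 ^ m - 1 - i)"
  have "\<tau> (a * ?a') = \<tau> ([:0, 1:] ^ i * ?a')"
    by (rule tau_mult_cong [OF 2(2) refl])
  also have "\<dots> = \<tau> ([:0, 1:] ^ (0 + (2 ^ m - 1) * 1))"
    using 2(1) by (simp flip: power_add)
  also have "\<dots> = \<tau> 1"
    using tau_cong [OF residue_class_X_power [OF h_dvd, of 0 1]] by simp
  finally have 1: "\<tau> (a * ?a') = \<tau> 1" .
  have "\<tau> ?a' \<noteq> \<zero>\<^bsub>poly_quot h\<^esub>"
  proof
    assume "\<tau> ?a' = \<zero>\<^bsub>poly_quot h\<^esub>"
    then have "\<tau> (a * ?a') = \<tau> (a * 0)" by (intro tau_mult_cong) (simp_all add: tau_0)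
    then have "\<tau> (a * 1) = \<tau> (a * 0)" using 1 by (intro tau_mult_cong) simp_all
    then show False using assms by (simp add: tau_0)
  qed
  with 1 show thesis by (rule that)
qed (use assms in blast)

lemma tau_mult_eq_0:
  assumes "\<tau> (a * b) = \<zero>\<^bsub>poly_quot h\<^esub>" "\<tau> a \<noteq> \<zero>\<^bsub>poly_quot h\<^esub>"
  shows "\<tau> b = \<zero>\<^bsub>poly_quot h\<^esub>"
proof -
  obtain a' where a': "\<tau> (a * a') = \<tau> 1" using tau_inverse [OF assms(2)] by metis
  have "\<tau> b = \<tau> (1 * b)" by simp
  also have "\<dots> = \<tau> ((a * a') * b)" by (rule tau_mult_cong) (simp_all add: a')
  also have "\<dots> = \<tau> (a' * (a * b))" by (simp add: mult_ac)
  also have "\<dots> = \<tau> (a' * 0)" by (rule tau_mult_cong) (simp_all add: assms tau_0)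
  finally show ?thesis by (simp add: tau_0)
qed

text \<open>The inner powers coming from the coefficients and the argument are absorbed by
  \<open>tau_power\<close>. All claims about the group thereby become algebra on
  representatives.\<close>

lemma affine_map_tau: "affine_map m h (\<tau> a) (\<tau> b) (\<tau> x) = \<tau> (a * x + b)"
proof -
  have "affine_map m h (\<tau> a) (\<tau> b) (\<tau> x) = \<tau> (a ^ (2 ^ m) * x ^ (2 ^ m) + b ^ (2 ^ m))"
    by (simp add: affine_map_def teich_eq \<tau>_def residue_class_add residue_class_mult
        residue_class_power)
  also have "\<dots> = \<tau> (a * x + b)"
    by (intro tau_add_cong tau_mult_cong tau_power)
  finally show ?thesis .
qed

subsection \<open>The affine group\<close>

lemma affine_permsE:
  assumes "g \<in> affine_perms m h"
  obtains a b where "g = affine_map m h (\<tau> a) (\<tau> b)" "\<tau> a \<noteq> \<zero>\<^bsub>poly_quot h\<^esub>"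
  using assms by (auto simp: affine_perms_def teich_eq)

lemma affine_permsI: "\<tau> a \<noteq> \<zero>\<^bsub>poly_quot h\<^esub> \<Longrightarrow> affine_map m h (\<tau> a) (\<tau> b) \<in> affine_perms m h"
  by (auto simp: affine_perms_def teich_eq)

lemma affine_map_extensional: "affine_map m h a b \<in> extensional (teich m h)"
  by (simp add: affine_map_def)

lemma affine_map_compose:
  "compose (teich m h) (affine_map m h (\<tau> a) (\<tau> b)) (affine_map m h (\<tau> a') (\<tau> b')) =
    affine_map m h (\<tau> (a * a')) (\<tau> (a * b' + b))"
proof (rule extensionalityI [OF _ affine_map_extensional])
  fix x assume "x \<in> teich m h"
  then obtain u where "x = \<tau> u" by (auto simp: teich_eq)
  then show "compose (teich m h) (affine_map m h (\<tau> a) (\<tau> b)) (affine_map m h (\<tau> a') (\<tau> b')) x =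
      affine_map m h (\<tau> (a * a')) (\<tau> (a * b' + b)) x"
    by (simp add: compose_def teich_eq affine_map_tau algebra_simps)
qed (simp add: compose_def)

text \<open>The coefficients are constrained only through \<tau>, because composing a map with its
  inverse yields 1 and 0 only up to the residue field.\<close>

lemma affine_map_id:
  assumes "\<tau> a = \<tau> 1" "\<tau> b = \<zero>\<^bsub>poly_quot h\<^esub>"
  shows "affine_map m h (\<tau> a) (\<tau> b) = (\<lambda>x\<in>teich m h. x)"
proof (rule extensionalityI [OF affine_map_extensional])
  fix x assume "x \<in> teich m h"
  then obtain u where u: "x = \<tau> u" by (auto simp: teich_eq)
  have "\<tau> (a * u + b) = \<tau> (1 * u + 0)"
    by (intro tau_add_cong tau_mult_cong) (simp_all add: assms tau_0)
  then show "affine_map m h (\<tau> a) (\<tau> b) x = (\<lambda>x\<in>teich m h. x) x"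
    by (simp add: u affine_map_tau teich_eq)
qed simp

text \<open>The inverse of \<open>a * x + b\<close> is \<open>a' * x - a' * b\<close> with
  \<open>a'\<close> inverse to \<open>a\<close>. Both compositions are recorded since bijectivity
  uses both.\<close>

lemma affine_map_inverse:
  assumes "g \<in> affine_perms m h"
  obtains g' where "g' \<in> affine_perms m h"
    "compose (teich m h) g' g = (\<lambda>x\<in>teich m h. x)" "compose (teich m h) g g' = (\<lambda>x\<in>teich m h. x)"
proof -
  obtain a b where g: "g = affine_map m h (\<tau> a) (\<tau> b)" and a: "\<tau> a \<noteq> \<zero>\<^bsub>poly_quot h\<^esub>"
    using assms by (rule affine_permsE)
  obtain a' where a': "\<tau> (a * a') = \<tau> 1" "\<tau> a' \<noteq> \<zero>\<^bsub>poly_quot h\<^esub>"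
    using a by (rule tau_inverse)
  have "\<tau> ((a * a') * - b + b) = \<tau> (1 * - b + b)"
    by (intro tau_add_cong tau_mult_cong a') simp_all
  then have "\<tau> (a * (- (a' * b)) + b) = \<zero>\<^bsub>poly_quot h\<^esub>"
    by (simp add: tau_0 mult_ac)
  then have "compose (teich m h) g (affine_map m h (\<tau> a') (\<tau> (- (a' * b)))) = (\<lambda>x\<in>teich m h. x)"
    unfolding g affine_map_compose by (rule affine_map_id [OF a'(1)])
  moreover have "compose (teich m h) (affine_map m h (\<tau> a') (\<tau> (- (a' * b)))) g = (\<lambda>x\<in>teich m h. x)"
    unfolding g affine_map_compose using a'(1)
    by (intro affine_map_id) (simp_all add: tau_0 mult.commute)
  ultimately show thesis using that affine_permsI [OF a'(2)] by blast
qed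

lemma affine_perms_maps_to: "g \<in> affine_perms m h \<Longrightarrow> x \<in> teich m h \<Longrightarrow> g x \<in> teich m h"
  by (auto simp: teich_eq affine_map_tau elim!: affine_permsE)

lemma affine_perms_Bij: "affine_perms m h \<subseteq> Bij (teich m h)"
proof
  fix g assume g: "g \<in> affine_perms m h"
  then obtain g' where g': "g' \<in> affine_perms m h"
    "compose (teich m h) g' g = (\<lambda>x\<in>teich m h. x)" "compose (teich m h) g g' = (\<lambda>x\<in>teich m h. x)"
    by (rule affine_map_inverse)
  have "g' (g x) = x" "g (g' x) = x" if "x \<in> teich m h" for x
    using that fun_cong [OF g'(2), of x] fun_cong [OF g'(3), of x] by (simp_all add: compose_def)
  then have "bij_betw g (teich m h) (teich m h)"
    using affine_perms_maps_to g g'(1) by (intro bij_betw_byWitness [of _ g']) auto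
  then show "g \<in> Bij (teich m h)"
    using g by (auto simp: Bij_def affine_map_extensional elim: affine_permsE)
qed

lemma affine_perms_nonempty: "affine_perms m h \<noteq> {}"
proof -
  have "\<exists>a. \<tau> a \<noteq> \<zero>\<^bsub>poly_quot h\<^esub>"
  proof (rule ccontr)
    assume "\<not> ?thesis"
    then have "card (teich m h) \<le> card {\<zero>\<^bsub>poly_quot h\<^esub>}"
      by (intro card_mono) (auto simp: teich_eq)
    moreover have "(2 :: nat) ^ 1 \<le> 2 ^ m" using m_pos by (intro power_increasing) auto
    ultimately show False by (simp add: card_teich)
  qed
  then show ?thesis using affine_permsI by blast
qed

lemma subgroup_affine_perms: "subgroup (affine_perms m h) (BijGroup (teich m h))"
proof -
  interpret group "BijGroup (teich m h)" by (rule group_BijGroup)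
  have mult: "f \<otimes>\<^bsub>BijGroup (teich m h)\<^esub> g = compose (teich m h) f g"
    if "f \<in> affine_perms m h" "g \<in> affine_perms m h" for f g
    using that affine_perms_Bij by (auto simp: BijGroup_def)
  have carrier: "affine_perms m h \<subseteq> carrier (BijGroup (teich m h))"
    using affine_perms_Bij by (simp add: BijGroup_def)
  show ?thesis
  proof (rule subgroupI [OF carrier affine_perms_nonempty])
    fix g assume g: "g \<in> affine_perms m h"
    obtain g' where g': "g' \<in> affine_perms m h"
      "compose (teich m h) g' g = (\<lambda>x\<in>teich m h. x)"
      using g by (rule affine_map_inverse)
    then have "g' \<otimes>\<^bsub>BijGroup (teich m h)\<^esub> g = \<one>\<^bsub>BijGroup (teich m h)\<^esub>"
      by (simp add: mult g) (simp add: BijGroup_def)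
    then have "inv\<^bsub>BijGroup (teich m h)\<^esub> g = g'"
      using g g'(1) carrier by (intro inv_equality) auto
    then show "inv\<^bsub>BijGroup (teich m h)\<^esub> g \<in> affine_perms m h" using g' by simp
  next
    fix f g assume fg: "f \<in> affine_perms m h" "g \<in> affine_perms m h"
    obtain a b where f: "f = affine_map m h (\<tau> a) (\<tau> b)" "\<tau> a \<noteq> \<zero>\<^bsub>poly_quot h\<^esub>"
      using fg(1) by (rule affine_permsE)
    obtain a' b' where g: "g = affine_map m h (\<tau> a') (\<tau> b')" "\<tau> a' \<noteq> \<zero>\<^bsub>poly_quot h\<^esub>"
      using fg(2) by (rule affine_permsE)
    have "\<tau> (a * a') \<noteq> \<zero>\<^bsub>poly_quot h\<^esub>" using f g tau_mult_eq_0 by blast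
    then have "compose (teich m h) f g \<in> affine_perms m h"
      unfolding f g affine_map_compose by (rule affine_permsI)
    then show "f \<otimes>\<^bsub>BijGroup (teich m h)\<^esub> g \<in> affine_perms m h" by (simp add: mult fg)
  qed
qed

section \<open>Double transitivity and the order of the group\<close>

lemma doubly_transitive_affine_perms: "doubly_transitive_on (affine_perms m h) (teich m h)"
  unfolding doubly_transitive_on_def
proof (intro ballI impI)
  fix x y u v
  assume "x \<in> teich m h" "y \<in> teich m h" "u \<in> teich m h" "v \<in> teich m h"
    and neq: "x \<noteq> y" "u \<noteq> v"
  then obtain p q r s where eqs: "x = \<tau> p" "y = \<tau> q" "u = \<tau> r" "v = \<tau> s"
    by (auto simp: teich_eq)
  have diff: "\<tau> (f - g) \<noteq> \<zero>\<^bsub>poly_quot h\<^esub>" if "\<tau> f \<noteq> \<tau> g" for f g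
    using that by (simp add: tau_eq_0_iff tau_eq_iff residue_class_eq_iff reduce_poly_diff)
  obtain d where d: "\<tau> ((p - q) * d) = \<tau> 1"
    using tau_inverse diff neq eqs by metis
  \<comment> \<open>The slope of the line through the two prescribed points; the intercept is then
    \<open>r - a * p\<close>.\<close>
  define a where "a = (r - s) * d"
  have a: "\<tau> (a * (p - q)) = \<tau> (r - s)"
    using tau_mult_cong [OF refl d, of "r - s"] by (simp add: a_def mult_ac)
  have "\<tau> a \<noteq> \<zero>\<^bsub>poly_quot h\<^esub>"
  proof
    assume "\<tau> a = \<zero>\<^bsub>poly_quot h\<^esub>"
    then have "\<tau> (a * (p - q)) = \<tau> (0 * (p - q))" by (intro tau_mult_cong) (simp_all add: tau_0)
    then show False using diff [of r s] neq eqs a by (simp add: tau_0)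
  qed
  then have "affine_map m h (\<tau> a) (\<tau> (r - a * p)) \<in> affine_perms m h" by (rule affine_permsI)
  moreover have "affine_map m h (\<tau> a) (\<tau> (r - a * p)) x = u"
    by (simp add: eqs affine_map_tau)
  moreover have "affine_map m h (\<tau> a) (\<tau> (r - a * p)) y = v"
  proof -
    have "\<tau> (a * q + (r - a * p)) = \<tau> (r + - 1 * (a * (p - q)))" by (simp add: algebra_simps)
    also have "\<dots> = \<tau> (r + - 1 * (r - s))" by (intro tau_add_cong tau_mult_cong refl a)
    finally show ?thesis by (simp add: eqs affine_map_tau)
  qed
  ultimately show "\<exists>g\<in>affine_perms m h. g x = u \<and> g y = v" by blast
qed

text \<open>Coefficients can be read off the map: the value at 0 gives \<open>b\<close>, and
  subtracting it from the value at 1 gives \<open>a\<close>.\<close>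

lemma card_affine_perms: "card (affine_perms m h) = 2 ^ m * (2 ^ m - 1)"
proof -
  let ?S = "(teich m h - {\<zero>\<^bsub>poly_quot h\<^esub>}) \<times> teich m h"
  have "affine_perms m h = (\<lambda>(a, b). affine_map m h a b) ` ?S"
    by (auto simp: affine_perms_def image_def)
  moreover have "inj_on (\<lambda>(a, b). affine_map m h a b) ?S"
  proof (rule inj_onI)
    fix s t assume "s \<in> ?S" "t \<in> ?S"
      and eq: "(\<lambda>(a, b). affine_map m h a b) s = (\<lambda>(a, b). affine_map m h a b) t"
    then obtain p q p' q' where eqs: "s = (\<tau> p, \<tau> q)" "t = (\<tau> p', \<tau> q')"
      by (auto simp: teich_eq)
    have *: "\<tau> (p * x + q) = \<tau> (p' * x + q')" for x
      using fun_cong [OF eq, of "\<tau> x"] unfolding eqs by (simp add: affine_map_tau)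
    have b: "\<tau> q = \<tau> q'" using * [of 0] by simp
    moreover have "\<tau> (- 1 * q) = \<tau> (- 1 * q')" by (intro tau_mult_cong refl b)
    then have "\<tau> ((p * 1 + q) + - 1 * q) = \<tau> ((p' * 1 + q') + - 1 * q')"
      by (intro tau_add_cong *)
    ultimately show "s = t" by (simp add: eqs)
  qed
  ultimately have "card (affine_perms m h) = card ?S" by (simp add: card_image)
  also have "\<dots> = 2 ^ m * (2 ^ m - 1)"
  proof -
    have "\<zero>\<^bsub>poly_quot h\<^esub> \<in> teich m h" by (simp add: teich_def)
    then show ?thesis by (simp add: card_cartesian_product card_Diff_singleton card_teich)
  qed
  finally show ?thesis .
qed

subsection \<open>Invariance of the linear system\<close>

text \<open>Replaces \<open>finsum\<close> in the quotient by a polynomial sum, for any choice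
  \<open>r\<close> of representatives.\<close>

lemma power_moment_eq:
  assumes "\<And>x. x \<in> teich m h \<Longrightarrow> residue_class h (r x) = x"
  shows "power_moment m h c e = residue_class h (\<Sum>x\<in>teich m h. [:c x:] * r x ^ e)"
proof -
  interpret cring "poly_quot h" by (rule cring_poly_quot)
  show ?thesis
    unfolding power_moment_def residue_class_sum [OF finite_teich]
    by (rule finsum_cong')
      (simp_all only: residue_class_mult residue_class_power assms Pi_def residue_class_closed
        mem_Collect_eq ball_triv m_closed nat_pow_closed simp_thms)
qed

lemma solves_affine:
  assumes g: "g \<in> affine_perms m h" and c: "solves m h J c"
    and c': "\<And>x. x \<in> teich m h \<Longrightarrow> c' (g x) = c x"
  shows "solves m h J c'"
proof -
  let ?T = "teich m h"
  obtain a b where g_eq: "g = affine_map m h (\<tau> a) (\<tau> b)"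
    using g by (rule affine_permsE)
  have bij: "bij_betw g ?T ?T" using g affine_perms_Bij by (auto simp: Bij_def)
  have "\<forall>x\<in>?T. \<exists>u. residue_class h u = x \<and> \<tau> u = x" by (metis teich_rep)
  then obtain r where r: "\<And>x. x \<in> ?T \<Longrightarrow> residue_class h (r x) = x"
    and Kr: "\<And>x. x \<in> ?T \<Longrightarrow> \<tau> (r x) = x" by metis
  define M where "M e = (\<Sum>x\<in>?T. [:c x:] * r x ^ e)" for e
  define A where "A = a ^ (2 ^ m)"
  define B where "B = b ^ (2 ^ m)"
  \<comment> \<open>The exponent \<open>2 ^ k = 2 ^ (m - 1)\<close> is that of the single even
    correction in \<open>power_2power_Suc_add\<close>.\<close>
  obtain k where k: "m = Suc k" using m_pos by (cases m) auto
  define z where "z x = (a * b) ^ (2 ^ k) * r x ^ (2 ^ k)" for x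
  define Y where "Y x = (A * r x + B) + 2 * z x" for x

  have c0: "(\<Sum>x\<in>?T. c x) = 0" using c by (simp add: solves_def)
  \<comment> \<open>This moment is a constant polynomial, hence zero outright and not just modulo
    \<open>h\<close>.\<close>
  have M0: "M 0 = 0"
  proof -
    have "(\<Sum>x\<in>F. [:c x:]) = [:\<Sum>x\<in>F. c x:]" if "finite F" for F
      using that by (induction F rule: finite_induct) simp_all
    then show ?thesis by (simp add: M_def finite_teich c0)
  qed
  have zero_iff: "residue_class h f = \<zero>\<^bsub>poly_quot h\<^esub> \<longleftrightarrow> h dvd f" for f
    using residue_class_eq_iff [of h f 0] by (simp add: residue_class_0)
  have pm: "power_moment m h c e = residue_class h (M e)" for e
    unfolding M_def by (rule power_moment_eq [OF r])
  have M1: "h dvd M 1"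
    using c unfolding solves_def pm zero_iff by blast
  have MJ: "h dvd 2 * M (2 ^ j + 1)" if "j \<in> J" for j
    using c that unfolding solves_def pm residue_class_double [symmetric] zero_iff by blast
  \<comment> \<open>No equation of the system is spent on these exponents: they reduce to powers of
    the first moment.\<close>
  have M2: "h dvd 2 * M (2 ^ j)" for j
  proof -
    have "2 * M (2 ^ j) = 2 * M 1 ^ (2 ^ j)"
      unfolding M_def by (simp only: double_sum_power_2power [OF finite_teich] power_one_right)
    then show ?thesis using M1 by (metis dvd_mult dvd_power dvd_trans pos2 zero_less_power)
  qed

  \<comment> \<open>\<open>Y x\<close> is a polynomial formula for the image of \<open>x\<close>. It
    uses that \<open>r x\<close> represents its own lift, so that \<open>r x ^ (2 ^ m)\<close> may
    be replaced by \<open>r x\<close>.\<close>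
  have rg: "residue_class h (r (g x)) = residue_class h (Y x)" if "x \<in> ?T" for x
  proof -
    have "residue_class h (r (g x)) = \<tau> (a * r x + b)"
      using affine_map_tau [of a b "r x"] affine_perms_maps_to [OF g that] Kr [OF that]
      by (simp add: r g_eq)
    also have "\<dots> = residue_class h ((a * r x + b) ^ (2 ^ m))" by (rule \<tau>_def)
    also have "\<dots> = residue_class h (A * r x ^ (2 ^ m) + B + 2 * z x)"
      unfolding A_def B_def z_def k power_2power_Suc_add [OF four_poly_4]
      by (simp add: power_mult_distrib mult_ac)
    also have "\<dots> = residue_class h (Y x)"
      unfolding Y_def
      by (intro residue_class_add_cong residue_class_mult_cong refl)
        (simp add: r Kr that flip: \<tau>_def)
    finally show ?thesis .
  qed
  have moment: "power_moment m h c' e = residue_class h (\<Sum>x\<in>?T. [:c x:] * Y x ^ e)" for e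
  proof -
    have "power_moment m h c' e = residue_class h (\<Sum>x\<in>?T. [:c' (g x):] * r (g x) ^ e)"
      by (simp only: power_moment_eq [OF r] sum.reindex_bij_betw [OF bij, of "\<lambda>x. [:c' x:] * r x ^ e"])
    also have "\<dots> = residue_class h (\<Sum>x\<in>?T. [:c x:] * Y x ^ e)"
      by (intro residue_class_sum_cong finite_teich residue_class_mult_cong residue_class_power_cong rg)
        (simp add: c')
    finally show ?thesis .
  qed
  show ?thesis
    unfolding solves_def
  proof (intro conjI ballI)
    have "(\<Sum>x\<in>?T. c' x) = (\<Sum>x\<in>?T. c' (g x))"
      by (rule sum.reindex_bij_betw [OF bij, symmetric])
    then show "(\<Sum>x\<in>?T. c' x) = 0" by (simp add: c' c0)
  next
    \<comment> \<open>The correction \<open>2 * z x\<close> contributes the moment with exponent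
      \<open>2 ^ k\<close>, doubled and therefore covered by \<open>M2\<close>.\<close>
    have "(\<Sum>x\<in>?T. [:c x:] * Y x ^ 1) =
        (\<Sum>x\<in>?T. A * ([:c x:] * r x ^ 1) + B * ([:c x:] * r x ^ 0)
          + 2 * (a * b) ^ (2 ^ k) * ([:c x:] * r x ^ (2 ^ k)))"
      unfolding Y_def z_def
      by (intro sum.cong refl)
        (simp only: power_one_right power_0 distrib_left mult_ac mult_1_left mult_1_right)
    also have "\<dots> = A * M 1 + B * M 0 + (a * b) ^ (2 ^ k) * (2 * M (2 ^ k))"
      unfolding M_def sum.distrib sum_distrib_left by (simp only: mult_ac)
    also have "h dvd \<dots>" unfolding M0 by (intro dvd_add dvd_mult M1 M2) simp
    finally show "power_moment m h c' 1 = \<zero>\<^bsub>poly_quot h\<^esub>" by (simp only: moment zero_iff)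
  next
    fix j assume j: "j \<in> J"
    let ?q = "2 ^ j :: nat"
    \<comment> \<open>The factor 2 discards \<open>2 * z x\<close> and makes the power
      \<open>?q\<close> additive, leaving a product of a linear expression in
      \<open>r x ^ ?q\<close> and one in \<open>r x\<close>.\<close>
    have Y2: "2 * Y x ^ (?q + 1) = 2 * ((A ^ ?q * r x ^ ?q + B ^ ?q) * (A * r x + B))" for x
    proof -
      have "2 * Y x ^ (?q + 1) = 2 * (A * r x + B) ^ ?q * (A * r x + B)"
        unfolding Y_def double_power_add_double [OF four_poly_4] by (simp add: mult_ac)
      then show ?thesis
        unfolding double_power_2power_add [OF four_poly_4] power_mult_distrib
        by (simp only: mult.assoc)
    qed
    have expand: "C * (2 * ((P * u + Q) * (A * v + B))) = P * A * (2 * (C * (u * v)))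
        + P * B * (2 * (C * u)) + (Q * A * (2 * (C * v)) + Q * B * (2 * (C * 1)))"
      for C P Q u v :: "4 poly"
      by (simp add: algebra_simps)
    \<comment> \<open>The product has four terms, with exponents \<open>?q + 1\<close>,
      \<open>?q\<close>, 1 and 0. Only the first calls on the equation for this same
      \<open>j\<close>, so any index set \<open>J\<close> is preserved.\<close>
    have "2 * (\<Sum>x\<in>?T. [:c x:] * Y x ^ (?q + 1)) =
        (\<Sum>x\<in>?T. A ^ ?q * A * (2 * ([:c x:] * r x ^ (?q + 1)))
          + A ^ ?q * B * (2 * ([:c x:] * r x ^ ?q))
          + (B ^ ?q * A * (2 * ([:c x:] * r x ^ 1)) + B ^ ?q * B * (2 * ([:c x:] * r x ^ 0))))"
      unfolding sum_distrib_left mult.left_commute [of 2 "[:c _:]"] Y2 expand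
      by (simp only: power_one_right power_0 power_add
          mult.left_commute [of 2 "[:c _:]"])
    also have "\<dots> = A ^ ?q * A * (2 * M (?q + 1)) + A ^ ?q * B * (2 * M ?q)
        + (B ^ ?q * A * (2 * M 1) + B ^ ?q * B * (2 * M 0))"
      unfolding M_def sum.distrib sum_distrib_left by (simp only:)
    also have "h dvd \<dots>"
      unfolding M0 by (intro dvd_add dvd_mult M1 M2 MJ j) simp
    finally have "residue_class h (2 * (\<Sum>x\<in>?T. [:c x:] * Y x ^ (?q + 1))) = \<zero>\<^bsub>poly_quot h\<^esub>"
      by (simp only: zero_iff)
    then show "[(2::nat)] \<cdot>\<^bsub>poly_quot h\<^esub> power_moment m h c' (2 ^ j + 1) = \<zero>\<^bsub>poly_quot h\<^esub>"
      by (simp only: moment residue_class_double)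
  qed
qed

end

theorem theorem20:
  fixes m :: nat and h2 :: "bit poly" and h :: "4 poly" and J :: "nat set"
  assumes "m \<ge> 1"
    and "basic_primitive_lift m h2 h"
  shows "subgroup (affine_perms m h) (BijGroup (teich m h)) \<and>
    doubly_transitive_on (affine_perms m h) (teich m h) \<and>
    (\<forall>g\<in>affine_perms m h. \<forall>c c'. solves m h J c \<longrightarrow>
       (\<forall>x\<in>teich m h. c' (g x) = c x) \<longrightarrow> solves m h J c') \<and>
    card (affine_perms m h) = 2 ^ m * (2 ^ m - 1)"
proof -
  interpret primitive_lift m h2 h
    using assms by unfold_locales
  show ?thesis
    using subgroup_affine_perms doubly_transitive_affine_perms card_affine_perms solves_affine
    by blast
qed

end
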